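(* Let $\mathbf C$ be an IT-category with an accuracy relation $\vartriangleright$, and let $\mathcal D$ be an object of $\mathbf C$. Assume that there exists an object $\widetilde{\mathcal D}$ such that for every object $\mathcal B$ and every $b:\mathcal D\to\mathcal B$ there exists $b':\mathcal D\to\widetilde{\mathcal D}$ with $b\sim b'$. Take the decision object $\mathcal U:=\widetilde{\mathcal D}$ and the preorder $\gg$ on $\mathbf C(\mathcal D,\mathcal U)$ defined by $c\gg d\iff c\vartriangleright d$. Then for all morphisms $a,b$ of $\mathbf C$ with source $\mathcal D$, $a\succcurlyeq b$ if and only if $a\sqsupseteq b$.
   Context: A category of information transformers (IT-category) is a category $\mathbf C$ (composition $\circ$, identities $i_{\mathcal A}$) such that: (1) there is a fixed subcategory $\mathbf D$ (of deterministic ITs) containing all objects of $\mathbf C$; (2) the isomorphisms of $\mathbf C$ and of $\mathbf D$ coincide; (3) $\mathbf C$ and $\mathbf D$ have a common terminal object $\mathcal Z$; (4) $\mathbf D$ has (chosen) pairwise products $\mathcal A\times\mathcal B$ with projections $\pi_{\mathcal A,\mathcal B}$, $\nu_{\mathcal A,\mathcal B}$ onto $\mathcal A$, $\mathcal B$; for $a:\mathcal D\to\mathcal A$, $b:\mathcal D\to\mathcal B$ in $\mathbf D$ the induced morphism is denoted $a*b:\mathcal D\to\mathcal A\times\mathcal B$; (5) the operation $*$ is extended (by specified structure) to all pairs of morphisms $a:\mathcal D\to\mathcal A$, $b:\mathcal D\to\mathcal B$ of $\mathbf C$, so that $\pi_{\mathcal A,\mathcal B}\circ(a*b)=a$ and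 $\nu_{\mathcal A,\mathcal B}\circ(a*b)=b$ (uniqueness is not required in $\mathbf C$); (6) for $a:\mathcal A\to\mathcal C$, $b:\mathcal B\to\mathcal E$ in $\mathbf C$, with $a\times b:=(a\circ\pi_{\mathcal A,\mathcal B})*(b\circ\nu_{\mathcal A,\mathcal B})$, one has $(a\times b)\circ(c*d)=(a\circ c)*(b\circ d)$ for all $c:\mathcal D\to\mathcal A$, $d:\mathcal D\to\mathcal B$ in $\mathbf C$; (7) with $\sigma_{\mathcal A,\mathcal B}:=\nu_{\mathcal A,\mathcal B}*\pi_{\mathcal A,\mathcal B}$, one has $\sigma_{\mathcal A,\mathcal B}\circ(a*b)=b*a$ in $\mathbf C$; (8) with $\alpha_{\mathcal A,\mathcal B,\mathcal C}:=(\pi_{\mathcal A,\mathcal B}\circ\pi_{\mathcal A\times\mathcal B,\mathcal C})*\bigl((\nu_{\mathcal A,\mathcal B}\circ\pi_{\mathcal A\times\mathcal B,\mathcal C})*\nu_{\mathcal A\times\mathcal B,\mathcal C}\bigr)$, one has $\alpha_{\mathcal A,\mathcal B,\mathcal C}\circ((a*b)*c)=a*(b*c)$ in $\mathbf C$. An accuracy relation on $\mathbf C$ is a partial order $\vartriangleright$ on each hom-set $\mathbf C(\mathcal A,\mathcal B)$ such that $a\vartriangleright a'$, $b\vartriangleright b'$ imply $a\circ b\vartriangleright a'\circ b'$ and $a*b\vartriangleright a'*b'$ (whenever these are defined). For $a:\mathcal D\to\mathcal A$, $b:\mathcal D\to\mathcal B$: $a\succcurlyeq b$ ($a$ is more informative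 than $b$) if there is $c:\mathcal A\to\mathcal B$ with $c\circ a\vartriangleright b$; $a\sim b$ means $a\succcurlyeq b$ and $b\succcurlyeq a$. Given an object $\mathcal U$ and a preorder $\gg$ on $\mathbf C(\mathcal D,\mathcal U)$, the induced relation is: $a\sqsupseteq b$ iff for every $b':\mathcal B\to\mathcal U$ there is $a':\mathcal A\to\mathcal U$ with $a'\circ a\gg b'\circ b$. *)

theory Defs
  imports Main
begin

text \<open>
  Categories are presented by a set of objects and a set of arrows inside two ambient types.
  Every arrow carries its own source and target, so distinct hom-sets are disjoint.
  Composition is in the classical order, and is constrained only on composable arrows.
\<close>

record ('o, 'm) category =
  Obj :: "'o set"
  Arr :: "'m set"
  Dom :: "'m \<Rightarrow> 'o"
  Cod :: "'m \<Rightarrow> 'o"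
  Id :: "'o \<Rightarrow> 'm"
  Comp :: "'m \<Rightarrow> 'm \<Rightarrow> 'm"  (infixr "\<cdot>\<index>" 75)

definition hom :: "('o, 'm, 'x) category_scheme \<Rightarrow> 'o \<Rightarrow> 'o \<Rightarrow> 'm set" where
  "hom C A B = {f \<in> Arr C. Dom C f = A \<and> Cod C f = B}"

locale category =
  fixes C :: "('o, 'm, 'x) category_scheme" (structure)
  assumes Dom_in_Obj: "f \<in> Arr C \<Longrightarrow> Dom C f \<in> Obj C"
    and Cod_in_Obj: "f \<in> Arr C \<Longrightarrow> Cod C f \<in> Obj C"
    and Id_in_hom: "A \<in> Obj C \<Longrightarrow> Id C A \<in> hom C A A"
    and Comp_in_hom: "f \<in> hom C X Y \<Longrightarrow> g \<in> hom C Y Z \<Longrightarrow> g \<cdot> f \<in> hom C X Z"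
    and Id_left: "f \<in> hom C X Y \<Longrightarrow> Id C Y \<cdot> f = f"
    and Id_right: "f \<in> hom C X Y \<Longrightarrow> f \<cdot> Id C X = f"
    and Comp_assoc:
      "f \<in> hom C W X \<Longrightarrow> g \<in> hom C X Y \<Longrightarrow> h \<in> hom C Y Z \<Longrightarrow>
        (h \<cdot> g) \<cdot> f = h \<cdot> (g \<cdot> f)"

definition isomorphism :: "('o, 'm, 'x) category_scheme \<Rightarrow> 'm \<Rightarrow> bool" where
  "isomorphism C f \<longleftrightarrow>
    f \<in> Arr C \<and>
    (\<exists>g \<in> hom C (Cod C f) (Dom C f).
      g \<cdot>\<^bsub>C\<^esub> f = Id C (Dom C f) \<and> f \<cdot>\<^bsub>C\<^esub> g = Id C (Cod C f))"

definition terminal_object :: "('o, 'm, 'x) category_scheme \<Rightarrow> 'o \<Rightarrow> bool" where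
  "terminal_object C Z \<longleftrightarrow> Z \<in> Obj C \<and> (\<forall>A \<in> Obj C. \<exists>!f. f \<in> hom C A Z)"

definition induced ::
    "('o, 'm, 'x) category_scheme \<Rightarrow> 'o \<Rightarrow> 'm \<Rightarrow> 'm \<Rightarrow> 'o \<Rightarrow> 'm \<Rightarrow> 'm \<Rightarrow> 'm \<Rightarrow> bool" where
  "induced C P p q X a b h \<longleftrightarrow> h \<in> hom C X P \<and> p \<cdot>\<^bsub>C\<^esub> h = a \<and> q \<cdot>\<^bsub>C\<^esub> h = b"

definition is_product ::
    "('o, 'm, 'x) category_scheme \<Rightarrow> 'o \<Rightarrow> 'o \<Rightarrow> 'o \<Rightarrow> 'm \<Rightarrow> 'm \<Rightarrow> bool" where
  "is_product C A B P p q \<longleftrightarrow>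
    P \<in> Obj C \<and> p \<in> hom C P A \<and> q \<in> hom C P B \<and>
    (\<forall>X \<in> Obj C. \<forall>a \<in> hom C X A. \<forall>b \<in> hom C X B. \<exists>!h. induced C P p q X a b h)"

text \<open>
  The structure of an IT-category; \<open>Det\<close> is the set of deterministic arrows.
\<close>

record ('o, 'm) it_structure = "('o, 'm) category" +
  Det :: "'m set"
  Prod :: "'o \<Rightarrow> 'o \<Rightarrow> 'o"  (infixr "\<otimes>\<index>" 70)
  Proj1 :: "'o \<Rightarrow> 'o \<Rightarrow> 'm"  ("\<pi>\<index>")
  Proj2 :: "'o \<Rightarrow> 'o \<Rightarrow> 'm"  ("\<nu>\<index>")
  Pair :: "'m \<Rightarrow> 'm \<Rightarrow> 'm"  (infixr "\<star>\<index>" 72)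

definition det_category :: "('o, 'm, 'x) it_structure_scheme \<Rightarrow> ('o, 'm, 'x) it_structure_scheme"
  where "det_category C = C\<lparr>Arr := Det C\<rparr>"

definition arr_times :: "('o, 'm, 'x) it_structure_scheme \<Rightarrow> 'm \<Rightarrow> 'm \<Rightarrow> 'm" where
  "arr_times C a b =
    (a \<cdot>\<^bsub>C\<^esub> \<pi>\<^bsub>C\<^esub> (Dom C a) (Dom C b)) \<star>\<^bsub>C\<^esub> (b \<cdot>\<^bsub>C\<^esub> \<nu>\<^bsub>C\<^esub> (Dom C a) (Dom C b))"

definition swap :: "('o, 'm, 'x) it_structure_scheme \<Rightarrow> 'o \<Rightarrow> 'o \<Rightarrow> 'm" where
  "swap C A B = \<nu>\<^bsub>C\<^esub> A B \<star>\<^bsub>C\<^esub> \<pi>\<^bsub>C\<^esub> A B"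

definition associator :: "('o, 'm, 'x) it_structure_scheme \<Rightarrow> 'o \<Rightarrow> 'o \<Rightarrow> 'o \<Rightarrow> 'm" where
  "associator C A B E =
    (\<pi>\<^bsub>C\<^esub> A B \<cdot>\<^bsub>C\<^esub> \<pi>\<^bsub>C\<^esub> (A \<otimes>\<^bsub>C\<^esub> B) E) \<star>\<^bsub>C\<^esub>
      ((\<nu>\<^bsub>C\<^esub> A B \<cdot>\<^bsub>C\<^esub> \<pi>\<^bsub>C\<^esub> (A \<otimes>\<^bsub>C\<^esub> B) E) \<star>\<^bsub>C\<^esub> \<nu>\<^bsub>C\<^esub> (A \<otimes>\<^bsub>C\<^esub> B) E)"

locale it_category = category C
  for C :: "('o, 'm, 'x) it_structure_scheme" (structure) +
  assumes Det_subset: "Det C \<subseteq> Arr C"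
    and Det_category: "category (det_category C)"
    and isomorphism_iff: "isomorphism C f \<longleftrightarrow> isomorphism (det_category C) f"
    and common_terminal: "\<exists>Z. terminal_object C Z \<and> terminal_object (det_category C) Z"
    and Det_product:
      "A \<in> Obj C \<Longrightarrow> B \<in> Obj C \<Longrightarrow>
        is_product (det_category C) A B (A \<otimes> B) (\<pi> A B) (\<nu> A B)"
    and Det_Pair:
      "a \<in> hom (det_category C) X A \<Longrightarrow> b \<in> hom (det_category C) X B \<Longrightarrow>
        induced (det_category C) (A \<otimes> B) (\<pi> A B) (\<nu> A B) X a b (a \<star> b)"
    and Pair_in_hom:
      "a \<in> hom C X A \<Longrightarrow> b \<in> hom C X B \<Longrightarrow> a \<star> b \<in> hom C X (A \<otimes> B)"
    and Proj1_Pair: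
      "a \<in> hom C X A \<Longrightarrow> b \<in> hom C X B \<Longrightarrow> \<pi> A B \<cdot> (a \<star> b) = a"
    and Proj2_Pair:
      "a \<in> hom C X A \<Longrightarrow> b \<in> hom C X B \<Longrightarrow> \<nu> A B \<cdot> (a \<star> b) = b"
    and arr_times_Pair:
      "a \<in> hom C A A' \<Longrightarrow> b \<in> hom C B B' \<Longrightarrow> c \<in> hom C X A \<Longrightarrow> d \<in> hom C X B \<Longrightarrow>
        arr_times C a b \<cdot> (c \<star> d) = (a \<cdot> c) \<star> (b \<cdot> d)"
    and swap_Pair:
      "a \<in> hom C X A \<Longrightarrow> b \<in> hom C X B \<Longrightarrow> swap C A B \<cdot> (a \<star> b) = b \<star> a"
    and associator_Pair:
      "a \<in> hom C X A \<Longrightarrow> b \<in> hom C X B \<Longrightarrow> c \<in> hom C X E \<Longrightarrow>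
        associator C A B E \<cdot> ((a \<star> b) \<star> c) = a \<star> (b \<star> c)"

text \<open>
  Since hom-sets are disjoint, one relation on arrows carries a partial order on each of them;
  its values on non-parallel arrows are irrelevant.
\<close>

locale accuracy_relation = it_category C
  for C :: "('o, 'm, 'x) it_structure_scheme" (structure) +
  fixes acc :: "'m \<Rightarrow> 'm \<Rightarrow> bool"  (infix "\<rhd>" 50)
  assumes acc_refl: "reflp_on (hom C A B) (\<rhd>)"
    and acc_trans: "transp_on (hom C A B) (\<rhd>)"
    and acc_antisym: "antisymp_on (hom C A B) (\<rhd>)"
    and acc_Comp:
      "a \<in> hom C Y Z \<Longrightarrow> a' \<in> hom C Y Z \<Longrightarrow> b \<in> hom C X Y \<Longrightarrow> b' \<in> hom C X Y \<Longrightarrow>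
        a \<rhd> a' \<Longrightarrow> b \<rhd> b' \<Longrightarrow> a \<cdot> b \<rhd> a' \<cdot> b'"
    and acc_Pair:
      "a \<in> hom C X A \<Longrightarrow> a' \<in> hom C X A \<Longrightarrow> b \<in> hom C X B \<Longrightarrow> b' \<in> hom C X B \<Longrightarrow>
        a \<rhd> a' \<Longrightarrow> b \<rhd> b' \<Longrightarrow> a \<star> b \<rhd> a' \<star> b'"

text \<open>The following relations are meant for arrows \<open>a\<close> and \<open>b\<close> with a common source.\<close>

definition more_informative ::
    "('o, 'm, 'x) category_scheme \<Rightarrow> ('m \<Rightarrow> 'm \<Rightarrow> bool) \<Rightarrow> 'm \<Rightarrow> 'm \<Rightarrow> bool" where
  "more_informative C acc a b \<longleftrightarrow>
    (\<exists>c \<in> hom C (Cod C a) (Cod C b). acc (c \<cdot>\<^bsub>C\<^esub> a) b)"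

definition equally_informative ::
    "('o, 'm, 'x) category_scheme \<Rightarrow> ('m \<Rightarrow> 'm \<Rightarrow> bool) \<Rightarrow> 'm \<Rightarrow> 'm \<Rightarrow> bool" where
  "equally_informative C acc a b \<longleftrightarrow> more_informative C acc a b \<and> more_informative C acc b a"

definition induced_relation ::
    "('o, 'm, 'x) category_scheme \<Rightarrow> 'o \<Rightarrow> ('m \<Rightarrow> 'm \<Rightarrow> bool) \<Rightarrow> 'm \<Rightarrow> 'm \<Rightarrow> bool" where
  "induced_relation C U pref a b \<longleftrightarrow>
    (\<forall>b' \<in> hom C (Cod C b) U. \<exists>a' \<in> hom C (Cod C a) U. pref (a' \<cdot>\<^bsub>C\<^esub> a) (b' \<cdot>\<^bsub>C\<^esub> b))"

end

theory Submission
  imports Defs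
begin

text \<open>For the preference \<open>acc\<close>, the induced relation says exactly that
  \<open>a\<close> is more informative than every \<open>u \<cdot> b\<close> with \<open>u\<close>
  into the decision object. Informativeness is a preorder on arrows out of a fixed source, and
  postcomposition never gains information, so \<open>b\<close> dominates each
  \<open>u \<cdot> b\<close> and one direction is transitivity
  (\<open>induced_relation_if_more_informative\<close>). Conversely, the decision object is rich
  enough to hold an arrow \<open>b'\<close> equivalent to \<open>b\<close>; some
  \<open>u \<cdot> b\<close> is at least as accurate as \<open>b'\<close>, so \<open>a\<close>
  dominates \<open>u \<cdot> b\<close>, hence \<open>b'\<close>, hence \<open>b\<close>
  (\<open>more_informative_if_induced_relation\<close>).\<close>

context accuracy_relation
begin

lemma acc_trans_hom:
  assumes "x \<in> hom C A B" "y \<in> hom C A B" "z \<in> hom C A B" "x \<rhd> y" "y \<rhd> z"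
  shows "x \<rhd> z"
  using acc_trans assms by (rule transp_onD)

lemma acc_Comp_left:
  assumes "f \<in> hom C Y Z" "x \<in> hom C X Y" "y \<in> hom C X Y" "x \<rhd> y"
  shows "f \<cdot> x \<rhd> f \<cdot> y"
  using acc_Comp[OF assms(1,1-3)] reflp_onD[OF acc_refl assms(1)] assms(4) by blast

lemma more_informative_iff:
  assumes "a \<in> hom C X A" "b \<in> hom C X B"
  shows "more_informative C (\<rhd>) a b \<longleftrightarrow> (\<exists>c \<in> hom C A B. c \<cdot> a \<rhd> b)"
  using assms by (simp add: more_informative_def hom_def)

text \<open>The witnesses compose: monotonicity of composition carries the accuracy
  \<open>f \<cdot> a \<rhd> b\<close> through \<open>g\<close>, and transitivity of
  \<open>\<rhd>\<close> then reaches \<open>e\<close>.\<close>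

lemma more_informative_trans:
  assumes a: "a \<in> hom C X A" and b: "b \<in> hom C X B" and e: "e \<in> hom C X E"
    and ab: "more_informative C (\<rhd>) a b" and be: "more_informative C (\<rhd>) b e"
  shows "more_informative C (\<rhd>) a e"
proof -
  obtain f where f: "f \<in> hom C A B" "f \<cdot> a \<rhd> b"
    using ab more_informative_iff[OF a b] by blast
  obtain g where g: "g \<in> hom C B E" "g \<cdot> b \<rhd> e"
    using be more_informative_iff[OF b e] by blast
  have fa: "f \<cdot> a \<in> hom C X B" by (rule Comp_in_hom[OF a f(1)])
  have "g \<cdot> f \<cdot> a \<rhd> e"
    using Comp_in_hom[OF fa g(1)] Comp_in_hom[OF b g(1)] e acc_Comp_left[OF g(1) fa b f(2)] g(2)
    by (rule acc_trans_hom)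
  then have "(g \<cdot> f) \<cdot> a \<rhd> e"
    by (simp add: Comp_assoc[OF a f(1) g(1)])
  with Comp_in_hom[OF f(1) g(1)] show ?thesis
    using more_informative_iff[OF a e] by blast
qed

text \<open>With \<open>\<rhd>\<close> as preference, the arrow \<open>a'\<close> demanded for each
  decision \<open>u\<close> is precisely a witness of informativeness. Both directions below thus
  become arguments in the informativeness preorder.\<close>

lemma induced_relation_acc_iff:
  assumes "a \<in> hom C X A" "b \<in> hom C X B"
  shows "induced_relation C U (\<rhd>) a b \<longleftrightarrow>
    (\<forall>u \<in> hom C B U. more_informative C (\<rhd>) a (u \<cdot> b))"
  using assms more_informative_iff[OF assms(1) Comp_in_hom[OF assms(2)]]
  by (auto simp: induced_relation_def hom_def)

lemma induced_relation_if_more_informative: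
  assumes a: "a \<in> hom C X A" and b: "b \<in> hom C X B"
    and "more_informative C (\<rhd>) a b"
  shows "induced_relation C U (\<rhd>) a b"
  unfolding induced_relation_acc_iff[OF a b]
proof
  fix u assume u: "u \<in> hom C B U"
  have ub: "u \<cdot> b \<in> hom C X U" by (rule Comp_in_hom[OF b u])
  \<comment> \<open>The witness is \<open>u\<close> itself, by reflexivity of
    \<open>\<rhd>\<close>.\<close>
  have "more_informative C (\<rhd>) b (u \<cdot> b)"
    unfolding more_informative_iff[OF b ub] using u reflp_onD[OF acc_refl ub] by blast
  with a b ub assms(3) show "more_informative C (\<rhd>) a (u \<cdot> b)"
    by (rule more_informative_trans)
qed

text \<open>The chain of dominations runs from \<open>a\<close> through \<open>u \<cdot> b\<close>
  and \<open>b'\<close> to \<open>b\<close>. One half of the equivalence of \<open>b\<close> and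
  \<open>b'\<close> supplies \<open>u\<close>, the other half closes the chain.\<close>

lemma more_informative_if_induced_relation:
  assumes a: "a \<in> hom C X A" and b: "b \<in> hom C X B" and b': "b' \<in> hom C X U"
    and eq: "equally_informative C (\<rhd>) b b'"
    and ind: "induced_relation C U (\<rhd>) a b"
  shows "more_informative C (\<rhd>) a b"
proof -
  obtain u where u: "u \<in> hom C B U" "u \<cdot> b \<rhd> b'"
    using eq more_informative_iff[OF b b'] by (auto simp: equally_informative_def)
  have ub: "u \<cdot> b \<in> hom C X U" by (rule Comp_in_hom[OF b u(1)])
  have "more_informative C (\<rhd>) a (u \<cdot> b)"
    using ind u(1) induced_relation_acc_iff[OF a b] by blast
  \<comment> \<open>Accuracy between parallel arrows is a case of informativeness, witnessed by the
    identity.\<close>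
  moreover have "more_informative C (\<rhd>) (u \<cdot> b) b'"
    unfolding more_informative_iff[OF ub b']
  proof
    show "Id C U \<cdot> u \<cdot> b \<rhd> b'"
      using u(2) by (simp add: Id_left[OF ub])
    show "Id C U \<in> hom C U U"
      using ub Cod_in_Obj Id_in_hom by (auto simp: hom_def)
  qed
  ultimately have "more_informative C (\<rhd>) a b'"
    by (rule more_informative_trans[OF a ub b'])
  then show ?thesis
    using eq more_informative_trans[OF a b' b] by (simp add: equally_informative_def)
qed

end

text \<open>The theorem fixes \<open>pref\<close> only on one hom-set; both composites that the
  induced relation compares lie in it, so \<open>acc\<close> may replace
  \<open>pref\<close>.\<close>

lemma induced_relation_cong:
  assumes "category C" "a \<in> hom C X A" "b \<in> hom C X B"
    and "\<forall>c \<in> hom C X U. \<forall>d \<in> hom C X U. pref c d \<longleftrightarrow> pref' c d"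
  shows "induced_relation C U pref a b \<longleftrightarrow> induced_relation C U pref' a b"
proof -
  have "Cod C a = A" "Cod C b = B"
    using assms(2,3) by (simp_all add: hom_def)
  then show ?thesis
    using assms(4) category.Comp_in_hom[OF assms(1,2)] category.Comp_in_hom[OF assms(1,3)]
    unfolding induced_relation_def by metis
qed

theorem theorem8p3:
  fixes C :: "('o, 'm) it_structure"
    and acc pref :: "'m \<Rightarrow> 'm \<Rightarrow> bool"
    and D D' U :: 'o
  assumes "accuracy_relation C acc"
    and "D \<in> Obj C"
    and "D' \<in> Obj C"
    and "\<forall>B \<in> Obj C. \<forall>b \<in> hom C D B. \<exists>b' \<in> hom C D D'. equally_informative C acc b b'"
    and "U = D'"
    and "\<forall>c \<in> hom C D U. \<forall>d \<in> hom C D U. pref c d \<longleftrightarrow> acc c d"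
  shows "\<forall>A \<in> Obj C. \<forall>B \<in> Obj C. \<forall>a \<in> hom C D A. \<forall>b \<in> hom C D B.
    more_informative C acc a b \<longleftrightarrow> induced_relation C U pref a b"
proof (intro ballI)
  fix A B a b
  assume B: "B \<in> Obj C" and a: "a \<in> hom C D A" and b: "b \<in> hom C D B"
  interpret accuracy_relation C acc by (rule assms(1))
  obtain b' where "b' \<in> hom C D U" "equally_informative C acc b b'"
    using assms(4,5) B b by blast
  then have "more_informative C acc a b \<longleftrightarrow> induced_relation C U acc a b"
    using induced_relation_if_more_informative[OF a b]
      more_informative_if_induced_relation[OF a b] by blast
  also have "\<dots> \<longleftrightarrow> induced_relation C U pref a b"
    using induced_relation_cong[OF category_axioms a b assms(6)] by simp
  finally show "more_informative C acc a b \<longleftrightarrow> induced_relation C U pref a b" .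
qed

end
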